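(* Let the depth $h$ be reconstructed by the convex-combination minmod reconstruction described in the context, with $$\Delta b_j^\uparrow=\max\Big[\big|\tfrac{\Delta b_j}{2}-\alpha_{j-1/2}^{+}\Delta b_{j-1/2}\big|,\ \big|\tfrac{\Delta b_j}{2}\big|,\ \big|\tfrac{\Delta b_j}{2}-\alpha_j(b_{j+1}-b_{j-1})\big|,\ \big|\tfrac{\Delta b_j}{2}-\alpha_{j+1/2}^{-}\Delta b_{j+1/2}\big|,\ B_j\Big],$$ $$B_j=B(\phi_j,q_j)=\left(\frac{q_j^2}{\mathrm{Fr}^2(g'_p\phi_j+g'_a)}\right)^{1/3}.$$ Let $\Phi=\phi h$ be reconstructed with gradient $$[\Phi_x]_j=[\phi_x]_j\Big(h_j-\frac{\Delta x_j}{2}\big|[h_x]_j\big|\Big)+\phi_j[h_x]_j,\qquad [\phi_x]_j=\sigma(\phi_{j-1},\phi_j,\phi_{j+1};\{x\}),\qquad \phi_j=\Phi_j/h_j,$$ and interface values $\Phi_{j-1/2}^+=\Phi_j-\frac{\Delta x_j}{2}[\Phi_x]_j$, $\Phi_{j+1/2}^-=\Phi_j+\frac{\Delta x_j}{2}[\Phi_x]_j$, and let $\phi_{j-1/2}^+=\Phi_{j-1/2}^+/h_{j-1/2}^+$, $\phi_{j+1/2}^-=\Phi_{j+1/2}^-/h_{j+1/2}^-$. Then: (i) (self-monotonicity) $\phi_{j-1/2}^+$ and $\phi_{j+1/2}^-$ are non-decreasing functions of $\phi_j$; (ii) (neighbour-monotonicity) $\phi_{j-1/2}^+$ is a non-decreasing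 function of $\phi_{j-1}$, and $\phi_{j+1/2}^-$ is a non-decreasing function of $\phi_{j+1}$; (iii) $\phi_j^\downarrow\le\phi_{j-1/2}^+\le\phi_j^\uparrow$ and $\phi_j^\downarrow\le\phi_{j+1/2}^-\le\phi_j^\uparrow$. In (i) and (ii) all other data (all $h_k$, all $q_k$, the bed, and the remaining $\phi_k$) are held fixed.
   Context: Grid: $\{x\}=(x_{1/2}<x_{3/2}<\dots<x_{J+1/2})$, cells $C_j=(x_{j-1/2},x_{j+1/2})$, $\Delta x_j=x_{j+1/2}-x_{j-1/2}$; $j$ is a cell with neighbours $j-1,j+1$. Cell averages: depths $h_k>0$, volume fluxes $q_k\in\mathbb R$, $\Phi_k\ge0$, concentrations $\phi_k=\Phi_k/h_k\ge0$. Constants: $g'_p>0$, $g'_a\ge0$, $\mathrm{Fr}>0$, and $g'_p\phi_j+g'_a>0$ so that $B_j$ is defined. The bed elevation has known values $b_{k-1/2}^+,b_{k+1/2}^-$ at the ends of each cell $C_k$, with $b_k=\frac12(b_{k-1/2}^++b_{k+1/2}^-)$, $\Delta b_k=b_{k+1/2}^--b_{k-1/2}^+$, $[b_x]_k=\Delta b_k/\Delta x_k$, and $\eta_k=h_k+b_k$. For any field $v$, $\Delta v_{k+1/2}=v_{k+1}-v_k$. Minmod: $\operatorname{minmod}[y_1,\dots,y_n]$ equals $\min_i y_i$ if $\min_i y_i>0$, $\max_i y_i$ if $\max_i y_i<0$, and $0$ otherwise. The slope limiter is $$\sigma(v_{j-1},v_j,v_{j+1};\{x\})=\frac{2}{\Delta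 x_j}\operatorname{minmod}\big[\alpha_{j-1/2}^{+}(v_j-v_{j-1}),\ \alpha_j(v_{j+1}-v_{j-1}),\ \alpha_{j+1/2}^{-}(v_{j+1}-v_j)\big],$$ with $\alpha_j,\alpha_{j-1/2}^+,\alpha_{j+1/2}^-$ functions of $\{x\}$ with values in $[0,1]$ (the same for all fields); $\alpha_j^\uparrow=\max[\alpha_{j-1/2}^+,\alpha_{j+1/2}^-]$. For $v=h,\phi$, $v_j^\downarrow$ and $v_j^\uparrow$ are respectively the minimum and maximum of $v_j-\alpha_{j-1/2}^+\Delta v_{j-1/2},\ v_j,\ v_j+\alpha_{j+1/2}^-\Delta v_{j+1/2}$. Depth reconstruction: $[h_x]_j=(1-\gamma_j)\,\sigma(h_{j-1},h_j,h_{j+1};\{x\})+\gamma_j\,\big(\sigma(\eta_{j-1},\eta_j,\eta_{j+1};\{x\})-[b_x]_j\big)$, $h_{j-1/2}^+=h_j-\frac{\Delta x_j}{2}[h_x]_j$, $h_{j+1/2}^-=h_j+\frac{\Delta x_j}{2}[h_x]_j$. Here $0<G_j\le1-\alpha_j^\uparrow$ with $G_j$ a function of $\{x\}$, $\xi_j^C=1+1/G_j$, $\gamma_j=0$ if $\xi_j\le1$, $\gamma_j=G_j(\xi_j-1)$ if $1\le\xi_j\le\xi_j^C$, $\gamma_j=1$ if $\xi_j\ge\xi_j^C$, and $\xi_j=h_j^\downarrow/\Delta b_j^\uparrow$ ($=+\infty$ if $\Delta b_j^\uparrow=0$). *)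

theory Defs
  imports Complex_Main "HOL-Library.Extended_Real"
begin

text \<open>
  Cells carry integer indices \<open>1, \<dots>, J\<close>.  A grid \<open>x\<close> stores cell edges, with \<open>x k\<close> standing for
  \<open>x\<^bsub>k+1/2\<^esub>\<close> (\<open>0 \<le> k \<le> J\<close>), so that cell \<open>k\<close> is the interval from \<open>x (k - 1)\<close> to \<open>x k\<close>.
  Every quantity attached to one end of a cell is indexed by that cell: suffix \<open>left\<close> for
  the limit \<open>(k-1/2)\<^sup>+\<close> inside cell \<open>k\<close>, suffix \<open>right\<close> for the limit \<open>(k+1/2)\<^sup>-\<close> inside cell \<open>k\<close>.
\<close>

type_synonym grid = "int \<Rightarrow> real"
type_synonym field = "int \<Rightarrow> real"

definition cell_width :: "grid \<Rightarrow> int \<Rightarrow> real" where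
  "cell_width x k = x k - x (k - 1)"

text \<open>
  The limiter coefficients and \<open>G\<close> are functions of the grid and of nothing else:
  \<open>alpha_left\<close>, \<open>alpha_mid\<close>, \<open>alpha_right\<close> are \<open>\<alpha>\<^bsub>j-1/2\<^esub>\<^sup>+\<close>, \<open>\<alpha>\<^sub>j\<close>, \<open>\<alpha>\<^bsub>j+1/2\<^esub>\<^sup>-\<close>.
\<close>

record limiter =
  alpha_left :: "grid \<Rightarrow> int \<Rightarrow> real"
  alpha_mid :: "grid \<Rightarrow> int \<Rightarrow> real"
  alpha_right :: "grid \<Rightarrow> int \<Rightarrow> real"
  blend_G :: "grid \<Rightarrow> int \<Rightarrow> real"

record bed =
  bed_left :: field
  bed_right :: field

record physical_constants =
  grav_p :: real
  grav_a :: real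
  Froude :: real

definition alpha_up :: "limiter \<Rightarrow> grid \<Rightarrow> int \<Rightarrow> real" where
  "alpha_up S x j = max (alpha_left S x j) (alpha_right S x j)"

definition minmod :: "real list \<Rightarrow> real" where
  "minmod ys =
    (if Min (set ys) > 0 then Min (set ys)
     else if Max (set ys) < 0 then Max (set ys)
     else 0)"

definition slope :: "limiter \<Rightarrow> grid \<Rightarrow> field \<Rightarrow> int \<Rightarrow> real" where
  "slope S x v j = 2 / cell_width x j *
     minmod [alpha_left S x j * (v j - v (j - 1)),
             alpha_mid S x j * (v (j + 1) - v (j - 1)),
             alpha_right S x j * (v (j + 1) - v j)]"

definition local_min :: "limiter \<Rightarrow> grid \<Rightarrow> field \<Rightarrow> int \<Rightarrow> real" where
  "local_min S x v j =
     Min {v j - alpha_left S x j * (v j - v (j - 1)), v j,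
          v j + alpha_right S x j * (v (j + 1) - v j)}"

definition local_max :: "limiter \<Rightarrow> grid \<Rightarrow> field \<Rightarrow> int \<Rightarrow> real" where
  "local_max S x v j =
     Max {v j - alpha_left S x j * (v j - v (j - 1)), v j,
          v j + alpha_right S x j * (v (j + 1) - v j)}"

definition bed_avg :: "bed \<Rightarrow> field" where
  "bed_avg b k = (bed_left b k + bed_right b k) / 2"

definition bed_jump :: "bed \<Rightarrow> int \<Rightarrow> real" where
  "bed_jump b k = bed_right b k - bed_left b k"

definition bed_slope :: "bed \<Rightarrow> grid \<Rightarrow> int \<Rightarrow> real" where
  "bed_slope b x k = bed_jump b k / cell_width x k"

definition conc :: "field \<Rightarrow> field \<Rightarrow> field" where
  "conc h Phi k = Phi k / h k"

definition B_fun :: "physical_constants \<Rightarrow> real \<Rightarrow> real \<Rightarrow> real" where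
  "B_fun P c u = root 3 (u\<^sup>2 / ((Froude P)\<^sup>2 * (grav_p P * c + grav_a P)))"

definition bed_var_up ::
  "limiter \<Rightarrow> physical_constants \<Rightarrow> bed \<Rightarrow> grid \<Rightarrow> field \<Rightarrow> field \<Rightarrow> field \<Rightarrow> int \<Rightarrow> real" where
  "bed_var_up S P b x h q Phi j = Max
     {\<bar>bed_jump b j / 2 - alpha_left S x j * (bed_avg b j - bed_avg b (j - 1))\<bar>,
      \<bar>bed_jump b j / 2\<bar>,
      \<bar>bed_jump b j / 2 - alpha_mid S x j * (bed_avg b (j + 1) - bed_avg b (j - 1))\<bar>,
      \<bar>bed_jump b j / 2 - alpha_right S x j * (bed_avg b (j + 1) - bed_avg b j)\<bar>,
      B_fun P (conc h Phi j) (q j)}"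

definition xi ::
  "limiter \<Rightarrow> physical_constants \<Rightarrow> bed \<Rightarrow> grid \<Rightarrow> field \<Rightarrow> field \<Rightarrow> field \<Rightarrow> int \<Rightarrow> ereal" where
  "xi S P b x h q Phi j =
     (if bed_var_up S P b x h q Phi j = 0 then \<infinity>
      else ereal (local_min S x h j / bed_var_up S P b x h q Phi j))"

definition xi_C :: "limiter \<Rightarrow> grid \<Rightarrow> int \<Rightarrow> real" where
  "xi_C S x j = 1 + 1 / blend_G S x j"

text \<open>\<open>real_of_ereal\<close> is applied only in the middle branch, where \<open>\<xi>\<^sub>j\<close> is finite.\<close>

definition gamma_blend ::
  "limiter \<Rightarrow> physical_constants \<Rightarrow> bed \<Rightarrow> grid \<Rightarrow> field \<Rightarrow> field \<Rightarrow> field \<Rightarrow> int \<Rightarrow> real" where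
  "gamma_blend S P b x h q Phi j =
     (if xi S P b x h q Phi j \<le> 1 then 0
      else if xi S P b x h q Phi j \<le> ereal (xi_C S x j)
        then blend_G S x j * (real_of_ereal (xi S P b x h q Phi j) - 1)
      else 1)"

definition h_grad ::
  "limiter \<Rightarrow> physical_constants \<Rightarrow> bed \<Rightarrow> grid \<Rightarrow> field \<Rightarrow> field \<Rightarrow> field \<Rightarrow> int \<Rightarrow> real" where
  "h_grad S P b x h q Phi j =
     (1 - gamma_blend S P b x h q Phi j) * slope S x h j
     + gamma_blend S P b x h q Phi j *
         (slope S x (\<lambda>k. h k + bed_avg b k) j - bed_slope b x j)"

definition h_left ::
  "limiter \<Rightarrow> physical_constants \<Rightarrow> bed \<Rightarrow> grid \<Rightarrow> field \<Rightarrow> field \<Rightarrow> field \<Rightarrow> int \<Rightarrow> real" where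
  "h_left S P b x h q Phi j = h j - cell_width x j / 2 * h_grad S P b x h q Phi j"

definition h_right ::
  "limiter \<Rightarrow> physical_constants \<Rightarrow> bed \<Rightarrow> grid \<Rightarrow> field \<Rightarrow> field \<Rightarrow> field \<Rightarrow> int \<Rightarrow> real" where
  "h_right S P b x h q Phi j = h j + cell_width x j / 2 * h_grad S P b x h q Phi j"

definition Phi_grad ::
  "limiter \<Rightarrow> physical_constants \<Rightarrow> bed \<Rightarrow> grid \<Rightarrow> field \<Rightarrow> field \<Rightarrow> field \<Rightarrow> int \<Rightarrow> real" where
  "Phi_grad S P b x h q Phi j =
     slope S x (conc h Phi) j * (h j - cell_width x j / 2 * \<bar>h_grad S P b x h q Phi j\<bar>)
     + conc h Phi j * h_grad S P b x h q Phi j"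

definition Phi_left ::
  "limiter \<Rightarrow> physical_constants \<Rightarrow> bed \<Rightarrow> grid \<Rightarrow> field \<Rightarrow> field \<Rightarrow> field \<Rightarrow> int \<Rightarrow> real" where
  "Phi_left S P b x h q Phi j = Phi j - cell_width x j / 2 * Phi_grad S P b x h q Phi j"

definition Phi_right ::
  "limiter \<Rightarrow> physical_constants \<Rightarrow> bed \<Rightarrow> grid \<Rightarrow> field \<Rightarrow> field \<Rightarrow> field \<Rightarrow> int \<Rightarrow> real" where
  "Phi_right S P b x h q Phi j = Phi j + cell_width x j / 2 * Phi_grad S P b x h q Phi j"

definition conc_left ::
  "limiter \<Rightarrow> physical_constants \<Rightarrow> bed \<Rightarrow> grid \<Rightarrow> field \<Rightarrow> field \<Rightarrow> field \<Rightarrow> int \<Rightarrow> real" where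
  "conc_left S P b x h q Phi j = Phi_left S P b x h q Phi j / h_left S P b x h q Phi j"

definition conc_right ::
  "limiter \<Rightarrow> physical_constants \<Rightarrow> bed \<Rightarrow> grid \<Rightarrow> field \<Rightarrow> field \<Rightarrow> field \<Rightarrow> int \<Rightarrow> real" where
  "conc_right S P b x h q Phi j = Phi_right S P b x h q Phi j / h_right S P b x h q Phi j"

text \<open>
  \<open>set_conc h Phi k c\<close> gives cell \<open>k\<close> concentration \<open>c\<close> at unchanged depth.
  All other concentrations stay as they were.
\<close>

definition set_conc :: "field \<Rightarrow> field \<Rightarrow> int \<Rightarrow> real \<Rightarrow> field" where
  "set_conc h Phi k c = Phi(k := c * h k)"

end

theory Submission
  imports Defs
begin

text \<open>
  Write \<open>m\<close> and \<open>H\<close> for the increments of concentration and depth over half of cell \<open>j\<close>, that is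
  \<open>\<Delta>x\<^sub>j / 2\<close> times the reconstructed gradients.  The prescribed gradient of \<open>\<Phi>\<close> is designed so
  that
  \<open>\<phi>\<^bsub>j+1/2\<^esub>\<^sup>- = \<phi>\<^sub>j + m r(H)\<close> and \<open>\<phi>\<^bsub>j-1/2\<^esub>\<^sup>+ = \<phi>\<^sub>j - m r(-H)\<close>, where \<open>r(K) = (h\<^sub>j - |K|) / (h\<^sub>j + K)\<close>,
  and \<open>r\<close> takes values in \<open>[0, 1]\<close> as soon as \<open>|H| < h\<^sub>j\<close>.  Positivity of the depth holds because
  the minmod slope of \<open>h\<close> uses at most \<open>h\<^sub>j - h\<^sub>j\<^sup>\<down>\<close>, while blending in the slope of \<open>\<eta>\<close>
  changes this by \<open>\<gamma>\<^sub>j\<close> times a shift of size at most \<open>\<Delta>b\<^sub>j\<^sup>\<up>\<close>; the blending is active only when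
  \<open>\<Delta>b\<^sub>j\<^sup>\<up> < h\<^sub>j\<^sup>\<down>\<close>.

  Given this, the bounds (iii) are those of minmod, and (ii) is monotonicity of minmod, since the
  depth reconstruction does not see the neighbouring concentrations.

  Part (i) is the delicate one, because \<open>\<phi>\<^sub>j\<close> also enters \<open>r\<close>, through \<open>B\<^sub>j\<close> and \<open>\<gamma>\<^sub>j\<close>.  Put
  \<open>\<alpha> = \<alpha>\<^sub>j\<^sup>\<up>\<close> and let \<open>\<phi>\<^sub>j\<close> grow by \<open>\<delta>\<close>.  The increment \<open>m\<close> satisfies \<open>|m| \<le> \<alpha> \<phi>\<^sub>j\<close> and changes by at
  most \<open>\<alpha> \<delta>\<close>, so it remains to absorb \<open>\<alpha> \<phi>\<^sub>j |\<Delta>r|\<close> in \<open>(1 - \<alpha>) \<delta>\<close>.  The function \<open>r\<close> is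
  Lipschitz with constant \<open>2 / h\<^sub>j\<close>; the exponent \<open>1/3\<close> in \<open>B\<^sub>j\<close> gives \<open>\<phi>\<^sub>j |\<Delta>B| \<le> B \<delta> / 3\<close>; and
  since the shift multiplying \<open>\<gamma>\<^sub>j\<close> is bounded by the part of \<open>\<Delta>b\<^sub>j\<^sup>\<up>\<close> that comes from the bed, it
  compensates the denominator of \<open>\<xi>\<^sub>j\<close>, so that \<open>\<phi>\<^sub>j |\<Delta>H| \<le> G\<^sub>j h\<^sub>j \<delta> / 3\<close>.  Altogether
  \<open>\<alpha> \<phi>\<^sub>j |\<Delta>r| \<le> (2/3) G\<^sub>j \<delta> \<le> (1 - \<alpha>) \<delta>\<close>.
\<close>

section \<open>The minmod function of three arguments\<close>

text \<open>
  Minmod is the median of the smallest argument, the largest argument and zero.  In this form it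
  is visibly monotone, and commutes with a common shift of all the arguments and of the zero.
\<close>

lemma minmod3_median:
  "minmod [a, b, c] = max (min a (min b c)) (min 0 (max a (max b c)))"
  unfolding minmod_def by (simp add: max_def min_def)

lemma minmod3_mono:
  assumes "a \<le> a'" "b \<le> b'" "c \<le> c'"
  shows "minmod [a, b, c] \<le> minmod [a', b', c']"
  unfolding minmod3_median using assms by (intro max.mono min.mono order_refl)

lemma minmod3_bounds:
  assumes "y \<in> {a, b, c}"
  shows "min 0 y \<le> minmod [a, b, c]" "minmod [a, b, c] \<le> max 0 y"
  unfolding minmod3_median using assms by (auto simp: max_def min_def)

text \<open>
  The shift \<open>e\<close> acts on the zero inside minmod as well, which is why it has to obey the same
  bound as the perturbed arguments.
\<close>

lemma minmod3_shifted_diff: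
  assumes "\<bar>a - a' + e\<bar> \<le> N" "\<bar>b - b' + e\<bar> \<le> N" "\<bar>c - c' + e\<bar> \<le> N" "\<bar>e\<bar> \<le> N"
  shows "\<bar>minmod [a, b, c] - minmod [a', b', c'] + e\<bar> \<le> N"
proof -
  have shift: "minmod [u, v, w] + d
      = max (min (u + d) (min (v + d) (w + d))) (min d (max (u + d) (max (v + d) (w + d))))"
    for u v w d :: real
    unfolding minmod3_median by (simp add: max_def min_def)
  have "minmod [a, b, c] + e \<le> minmod [a', b', c'] + N"
    unfolding shift using assms by (intro max.mono min.mono) auto
  moreover have "minmod [a', b', c'] + - N \<le> minmod [a, b, c] + e"
    unfolding shift using assms by (intro max.mono min.mono) auto
  ultimately show ?thesis by linarith
qed

text \<open>Slopes are multiplied by half the cell width throughout, which leaves the bare minmod.\<close>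

lemma half_width_slope:
  assumes "cell_width x j > 0"
  shows "cell_width x j / 2 * slope S x v j =
    minmod [alpha_left S x j * (v j - v (j - 1)),
            alpha_mid S x j * (v (j + 1) - v (j - 1)),
            alpha_right S x j * (v (j + 1) - v j)]"
  using assms by (simp add: slope_def)

section \<open>The damping factor\<close>

text \<open>
  The factor by which the concentration increment is reduced at the end of a cell of mean depth
  \<open>h\<close> where the reconstructed depth is \<open>h + K\<close>: the smaller of the two end depths divided by
  the depth at this end.
\<close>

definition damping :: "real \<Rightarrow> real \<Rightarrow> real" where
  "damping h K = (h - \<bar>K\<bar>) / (h + K)"

lemma damping_eq:
  assumes "\<bar>K\<bar> < h"
  shows "damping h K = 2 * h / (h + max K 0) - 1"
  using assms by (auto simp: damping_def max_def field_simps abs_if)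

lemma damping_bounds:
  assumes "\<bar>K\<bar> < h"
  shows "0 \<le> damping h K" "damping h K \<le> 1"
  using assms by (auto simp: damping_def field_simps abs_if)

lemma damping_lipschitz:
  assumes "\<bar>K\<bar> < h" "\<bar>K'\<bar> < h"
  shows "h * \<bar>damping h K' - damping h K\<bar> \<le> 2 * \<bar>K' - K\<bar>"
proof -
  define p p' where "p = max K 0" and "p' = max K' 0"
  have h: "h > 0" and p: "p \<ge> 0" "p' \<ge> 0" using assms by (auto simp: p_def p'_def)
  have "damping h K' - damping h K = 2 * h * (p - p') / ((h + p) * (h + p'))"
    using h p by (simp add: damping_eq assms flip: p_def p'_def) (simp add: field_simps)
  then have "h * \<bar>damping h K' - damping h K\<bar> = 2 * \<bar>p - p'\<bar> * (h * h / ((h + p) * (h + p')))"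
    using h p by (simp add: abs_mult)
  also have "\<dots> \<le> 2 * \<bar>p - p'\<bar> * 1"
  proof (rule mult_left_mono)
    have "h * h \<le> (h + p) * (h + p')" using h p by (intro mult_mono) auto
    then show "h * h / ((h + p) * (h + p')) \<le> 1" using h p by (simp add: divide_le_eq_1)
  qed simp
  also have "\<dots> \<le> 2 * \<bar>K' - K\<bar>" by (auto simp: p_def p'_def)
  finally show ?thesis .
qed

text \<open>
  The bookkeeping behind self-monotonicity: part \<open>\<alpha>\<close> of the growth of \<open>c\<close> pays for the change of
  the increment \<open>m\<close>, the remaining part \<open>1 - \<alpha>\<close> for the change of its damping factor \<open>r\<close>.
\<close>

lemma damped_increment_mono:
  fixes \<alpha> c c' m m' r r' :: real
  assumes "c \<le> c'" "0 \<le> \<alpha>" "\<bar>m\<bar> \<le> \<alpha> * c" "\<bar>m' - m\<bar> \<le> \<alpha> * (c' - c)" "0 \<le> r'" "r' \<le> 1"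
    and "\<alpha> * (c * \<bar>r' - r\<bar>) \<le> (1 - \<alpha>) * (c' - c)"
  shows "c + m * r \<le> c' + m' * r'"
proof -
  have "\<bar>(m' - m) * r'\<bar> \<le> \<bar>m' - m\<bar> * 1"
    unfolding abs_mult using assms by (intro mult_left_mono) auto
  moreover have "\<bar>m * (r' - r)\<bar> \<le> \<alpha> * c * \<bar>r' - r\<bar>"
    unfolding abs_mult using assms by (intro mult_right_mono) auto
  ultimately have "- ((m' - m) * r' + m * (r' - r)) \<le> c' - c"
    using assms by (auto simp: algebra_simps)
  then show ?thesis by (simp add: algebra_simps)
qed

section \<open>The critical depth\<close>

text \<open>
  Since \<open>B\<close> is proportional to the power \<open>-1/3\<close> of \<open>g'\<^sub>p c + g'\<^sub>a\<close>, its logarithmic derivative in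
  \<open>c\<close> is at most \<open>1 / (3 c)\<close> in modulus; the second claim is the finite-difference form of this.
\<close>

lemma B_fun_decrease:
  assumes P: "grav_p P > 0" "grav_a P \<ge> 0"
    and c: "0 \<le> c" "grav_p P * c + grav_a P > 0" "c \<le> c'"
  shows "B_fun P c' u \<le> B_fun P c u"
    and "c * (B_fun P c u - B_fun P c' u) \<le> B_fun P c u * ((c' - c) / 3)"
proof -
  define y where "y = root 3 (grav_p P * c + grav_a P)"
  define y' where "y' = root 3 (grav_p P * c' + grav_a P)"
  define A where "A = root 3 (u\<^sup>2 / (Froude P)\<^sup>2)"
  have le: "grav_p P * c \<le> grav_p P * c'" using P c by simp
  have A: "A \<ge> 0" by (simp add: A_def real_root_ge_zero)
  have y: "0 < y" "y \<le> y'" using le c by (auto simp: y_def y'_def)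
  have y3: "y ^ 3 = grav_p P * c + grav_a P" "y' ^ 3 = grav_p P * c' + grav_a P"
    using le c by (auto simp: y_def y'_def)
  have B: "B_fun P c u = A / y" "B_fun P c' u = A / y'"
    by (simp_all add: B_fun_def A_def y_def y'_def flip: real_root_divide)
  show "B_fun P c' u \<le> B_fun P c u"
    unfolding B using A y by (intro divide_left_mono) auto
  have "3 * (grav_p P * c * (y' - y)) \<le> 3 * (y ^ 3 * (y' - y))"
    using y P by (intro mult_left_mono mult_right_mono) (auto simp: y3)
  also have "\<dots> \<le> (y' * (y'\<^sup>2 + y' * y + y\<^sup>2)) * (y' - y)"
  proof -
    have "y ^ 3 \<le> y' ^ 3" "y * y\<^sup>2 \<le> y' * y\<^sup>2" "y * y * y \<le> y' * y' * y"
      using y by (auto intro!: power_mono mult_mono)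
    then have "3 * y ^ 3 \<le> y' * (y'\<^sup>2 + y' * y + y\<^sup>2)"
      by (simp add: algebra_simps power2_eq_square power3_eq_cube)
    then show ?thesis
      using y by (simp add: mult_right_mono flip: mult.assoc)
  qed
  also have "\<dots> = y' * (y' ^ 3 - y ^ 3)"
    by (simp add: algebra_simps power2_eq_square power3_eq_cube)
  also have "\<dots> = grav_p P * (y' * (c' - c))" by (simp add: y3 algebra_simps)
  finally have "grav_p P * (3 * (c * (y' - y))) \<le> grav_p P * (y' * (c' - c))"
    by (simp add: algebra_simps)
  then have key: "3 * (c * (y' - y)) \<le> y' * (c' - c)" using P by simp
  have "c * (A / y - A / y') = A / (3 * y * y') * (3 * (c * (y' - y)))"
    using y by (simp add: field_simps)
  also have "\<dots> \<le> A / (3 * y * y') * (y' * (c' - c))"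
    using key A y by (intro mult_left_mono) auto
  also have "\<dots> = A / y * ((c' - c) / 3)" using y by (simp add: field_simps)
  finally show "c * (B_fun P c u - B_fun P c' u) \<le> B_fun P c u * ((c' - c) / 3)"
    unfolding B .
qed

section \<open>Reconstruction in a cell\<close>

text \<open>
  The part of \<open>\<Delta>b\<^sub>j\<^sup>\<up>\<close> that comes from the bed alone.  Unlike \<open>\<Delta>b\<^sub>j\<^sup>\<up>\<close> itself it does not change with
  \<open>\<phi>\<^sub>j\<close>.
\<close>

definition bed_var :: "limiter \<Rightarrow> bed \<Rightarrow> grid \<Rightarrow> int \<Rightarrow> real" where
  "bed_var S b x j = Max
     {\<bar>bed_jump b j / 2 - alpha_left S x j * (bed_avg b j - bed_avg b (j - 1))\<bar>,
      \<bar>bed_jump b j / 2\<bar>,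
      \<bar>bed_jump b j / 2 - alpha_mid S x j * (bed_avg b (j + 1) - bed_avg b (j - 1))\<bar>,
      \<bar>bed_jump b j / 2 - alpha_right S x j * (bed_avg b (j + 1) - bed_avg b j)\<bar>}"

text \<open>
  What full blending (\<open>\<gamma>\<^sub>j = 1\<close>) would add to the half-cell depth increment; it is independent of the
  concentrations.
\<close>

definition bed_shift :: "limiter \<Rightarrow> bed \<Rightarrow> grid \<Rightarrow> field \<Rightarrow> int \<Rightarrow> real" where
  "bed_shift S b x h j = cell_width x j / 2 *
     (slope S x (\<lambda>k. h k + bed_avg b k) j - bed_slope b x j - slope S x h j)"

definition depth_increment ::
  "limiter \<Rightarrow> physical_constants \<Rightarrow> bed \<Rightarrow> grid \<Rightarrow> field \<Rightarrow> field \<Rightarrow> field \<Rightarrow> int \<Rightarrow> real" where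
  "depth_increment S P b x h q Phi j = cell_width x j / 2 * h_grad S P b x h q Phi j"

lemma bed_var_up_eq:
  "bed_var_up S P b x h q Phi j = max (bed_var S b x j) (B_fun P (conc h Phi j) (q j))"
  unfolding bed_var_up_def bed_var_def by (simp add: ac_simps)

lemma bed_var_nonneg: "0 \<le> bed_var S b x j"
  unfolding bed_var_def by (simp add: le_max_iff_disj)

lemma depth_increment_eq:
  "depth_increment S P b x h q Phi j =
     cell_width x j / 2 * slope S x h j + gamma_blend S P b x h q Phi j * bed_shift S b x h j"
  by (simp add: depth_increment_def h_grad_def bed_shift_def algebra_simps)

text \<open>The concentration of cell \<open>j\<close> is the only one that the depth reconstruction sees.\<close>

lemma depth_increment_cong:
  assumes "conc h Phi j = conc h Phi' j"
  shows "depth_increment S P b x h q Phi j = depth_increment S P b x h q Phi' j"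
  using assms by (simp add: depth_increment_def h_grad_def gamma_blend_def xi_def bed_var_up_eq)

text \<open>
  No assumption is made on the concentrations, because monotonicity compares several concentration
  fields over one and the same cell.
\<close>

locale wet_cell =
  fixes S :: limiter and P :: physical_constants and b :: bed and x :: grid
    and h q :: field and j :: int
  assumes width: "cell_width x j > 0"
    and depth: "h (j - 1) > 0" "h j > 0" "h (j + 1) > 0"
    and gravity: "grav_p P > 0" "grav_a P \<ge> 0"
    and alpha: "alpha_left S x j \<in> {0..1}" "alpha_right S x j \<in> {0..1}"
    and G: "0 < blend_G S x j" "blend_G S x j \<le> 1 - alpha_up S x j"
begin

abbreviation "\<alpha> \<equiv> alpha_up S x j"
abbreviation "h_low \<equiv> local_min S x h j"
abbreviation "\<gamma> \<equiv> \<lambda>Phi. gamma_blend S P b x h q Phi j"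
abbreviation "\<delta>h \<equiv> \<lambda>Phi. depth_increment S P b x h q Phi j"
abbreviation "\<delta>\<phi> \<equiv> \<lambda>Phi. cell_width x j / 2 * slope S x (conc h Phi) j"

lemma alpha_up_bounds: "0 \<le> \<alpha>" "\<alpha> < 1" "alpha_left S x j \<le> \<alpha>" "alpha_right S x j \<le> \<alpha>"
  using alpha G by (auto simp: alpha_up_def)

lemma h_low_bounds: "0 < h_low" "h_low \<le> h j"
proof -
  have "h j - a * (h j - k) > 0" if "0 \<le> a" "a < 1" "k > 0" for a k
  proof -
    have "0 < (1 - a) * h j + a * k"
      using that depth by (intro add_pos_nonneg mult_pos_pos) auto
    then show ?thesis by (simp add: algebra_simps)
  qed
  from this[of "alpha_left S x j" "h (j - 1)"] this[of "alpha_right S x j" "h (j + 1)"]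
  show "0 < h_low"
    using alpha alpha_up_bounds depth by (auto simp: local_min_def algebra_simps)
  show "h_low \<le> h j" by (simp add: local_min_def)
qed

lemma slope_increment_le: "\<bar>cell_width x j / 2 * slope S x h j\<bar> \<le> h j - h_low"
proof -
  let ?l = "alpha_left S x j * (h j - h (j - 1))"
  let ?r = "alpha_right S x j * (h (j + 1) - h j)"
  let ?m = "alpha_mid S x j * (h (j + 1) - h (j - 1))"
  have "minmod [?l, ?m, ?r] \<le> max 0 ?l" "min 0 ?r \<le> minmod [?l, ?m, ?r]"
    using minmod3_bounds[of _ ?l ?m ?r] by auto
  then show ?thesis
    unfolding half_width_slope[OF width] local_min_def
    by (auto simp: max_def min_def abs_le_iff split: if_splits)
qed

text \<open>
  Replacing \<open>\<eta>\<close> by \<open>h\<close> perturbs each argument of minmod by the corresponding bed difference, and the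
  bed slope is the common shift; the four resulting terms are the ones collected in \<open>\<Delta>b\<^sub>j\<^sup>\<up>\<close>.
\<close>

lemma bed_shift_le: "\<bar>bed_shift S b x h j\<bar> \<le> bed_var S b x j"
proof -
  let ?v = "\<lambda>k. h k + bed_avg b k"
  let ?M = "\<lambda>v. minmod [alpha_left S x j * (v j - v (j - 1)),
                 alpha_mid S x j * (v (j + 1) - v (j - 1)),
                 alpha_right S x j * (v (j + 1) - v j)]"
  have "\<bar>?M ?v - ?M h + - (bed_jump b j / 2)\<bar> \<le> bed_var S b x j"
  proof (rule minmod3_shifted_diff)
    show "\<bar>alpha_left S x j * (?v j - ?v (j - 1)) - alpha_left S x j * (h j - h (j - 1))
        + - (bed_jump b j / 2)\<bar> \<le> bed_var S b x j"
      unfolding bed_var_def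
      by (rule Max_ge) (auto simp: algebra_simps abs_minus_commute)
    show "\<bar>alpha_mid S x j * (?v (j + 1) - ?v (j - 1)) - alpha_mid S x j * (h (j + 1) - h (j - 1))
        + - (bed_jump b j / 2)\<bar> \<le> bed_var S b x j"
      unfolding bed_var_def
      by (rule Max_ge) (auto simp: algebra_simps abs_minus_commute)
    show "\<bar>alpha_right S x j * (?v (j + 1) - ?v j) - alpha_right S x j * (h (j + 1) - h j)
        + - (bed_jump b j / 2)\<bar> \<le> bed_var S b x j"
      unfolding bed_var_def
      by (rule Max_ge) (auto simp: algebra_simps abs_minus_commute)
    show "\<bar>- (bed_jump b j / 2)\<bar> \<le> bed_var S b x j"
      unfolding bed_var_def by (rule Max_ge) auto
  qed
  moreover have "bed_shift S b x h j = ?M ?v - ?M h - bed_jump b j / 2"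
    unfolding bed_shift_def right_diff_distrib half_width_slope[OF width]
    using width by (simp add: bed_slope_def)
  ultimately show ?thesis by simp
qed

text \<open>
  On a bed that is not locally trivial \<open>\<xi>\<^sub>j\<close> is finite, and the three branches defining \<open>\<gamma>\<^sub>j\<close>
  form one truncated linear function of it.
\<close>

lemma gamma_clamp:
  assumes "bed_var S b x j > 0"
  shows "\<gamma> Phi = max 0 (min 1 (blend_G S x j *
    (h_low / max (bed_var S b x j) (B_fun P (conc h Phi j) (q j)) - 1)))"
proof -
  let ?M = "max (bed_var S b x j) (B_fun P (conc h Phi j) (q j))"
  have M: "?M > 0" using assms by auto
  have xi: "xi S P b x h q Phi j = ereal (h_low / ?M)"
    using M by (simp add: xi_def bed_var_up_eq)
  define t where "t = h_low / ?M - 1"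
  let ?g = "blend_G S x j"
  have t: "h_low / ?M = t + 1" by (simp add: t_def)
  have "\<gamma> Phi = (if t \<le> 0 then 0 else if t \<le> 1 / ?g then ?g * t else 1)"
    unfolding gamma_blend_def xi xi_C_def t by simp
  also have "\<dots> = max 0 (min 1 (?g * t))"
  proof -
    have "t \<le> 0 \<longleftrightarrow> ?g * t \<le> 0" "t \<le> 1 / ?g \<longleftrightarrow> ?g * t \<le> 1"
      using G by (simp_all add: mult_le_0_iff pos_le_divide_eq mult.commute)
    then show ?thesis by (auto simp: max_def min_def)
  qed
  finally show ?thesis by (simp only: t_def)
qed

text \<open>The blending is switched on only where the bed variation is below the local minimum depth.\<close>

lemma blended_shift_less: "\<bar>\<gamma> Phi * bed_shift S b x h j\<bar> < h_low"
proof (cases "bed_var S b x j > 0")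
  case False
  then have "bed_shift S b x h j = 0" using bed_shift_le by auto
  then show ?thesis using h_low_bounds by simp
next
  case True
  let ?N = "bed_var S b x j"
  let ?M = "max ?N (B_fun P (conc h Phi j) (q j))"
  have M: "?M > 0" using True by auto
  have g: "0 \<le> \<gamma> Phi" "\<gamma> Phi \<le> 1" by (simp_all add: gamma_clamp[OF True])
  show ?thesis
  proof (cases "h_low \<le> ?N")
    case True
    then have "h_low / ?M - 1 \<le> 0" using M by (auto simp: divide_le_eq_1 le_max_iff_disj)
    then have "blend_G S x j * (h_low / ?M - 1) \<le> 0" using G by (simp only: mult_le_0_iff) simp
    then have "\<gamma> Phi = 0" unfolding gamma_clamp[OF \<open>?N > 0\<close>] by linarith
    then show ?thesis using h_low_bounds by simp
  next
    case False
    have "\<bar>\<gamma> Phi * bed_shift S b x h j\<bar> \<le> 1 * \<bar>bed_shift S b x h j\<bar>"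
      unfolding abs_mult using g by (intro mult_right_mono) auto
    then show ?thesis using bed_shift_le False by linarith
  qed
qed

lemma depth_increment_less: "\<bar>\<delta>h Phi\<bar> < h j"
  unfolding depth_increment_eq
  using slope_increment_le blended_shift_less[of Phi] by linarith

text \<open>
  In \<open>\<Phi> = \<phi> h\<close> the concentration slope is weighted by the smaller of the two end depths, while the
  term \<open>\<phi>\<^sub>j [h\<^sub>x]\<^sub>j\<close> reproduces a constant concentration; dividing by the end depth leaves \<open>\<phi>\<^sub>j\<close> plus a
  damped increment.
\<close>

lemma conc_right_eq: "conc_right S P b x h q Phi j = conc h Phi j + \<delta>\<phi> Phi * damping (h j) (\<delta>h Phi)"
proof -
  have Phi: "Phi j = conc h Phi j * h j" using depth by (simp add: conc_def)
  have "cell_width x j / 2 * Phi_grad S P b x h q Phi j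
      = \<delta>\<phi> Phi * (h j - \<bar>\<delta>h Phi\<bar>) + conc h Phi j * \<delta>h Phi"
    using width by (simp add: Phi_grad_def depth_increment_def abs_mult algebra_simps)
  then have "Phi_right S P b x h q Phi j
      = conc h Phi j * (h j + \<delta>h Phi) + \<delta>\<phi> Phi * (h j - \<bar>\<delta>h Phi\<bar>)"
    unfolding Phi_right_def by (subst Phi) (simp add: algebra_simps)
  moreover have "h_right S P b x h q Phi j = h j + \<delta>h Phi"
    by (simp add: h_right_def depth_increment_def)
  moreover have "h j + \<delta>h Phi \<noteq> 0" using depth_increment_less[of Phi] by linarith
  ultimately show ?thesis
    by (simp only: conc_right_def damping_def add_divide_distrib times_divide_eq_right
        nonzero_mult_div_cancel_right not_False_eq_True)
qed

lemma conc_left_eq: "conc_left S P b x h q Phi j = conc h Phi j - \<delta>\<phi> Phi * damping (h j) (- \<delta>h Phi)"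
proof -
  have Phi: "Phi j = conc h Phi j * h j" using depth by (simp add: conc_def)
  have "cell_width x j / 2 * Phi_grad S P b x h q Phi j
      = \<delta>\<phi> Phi * (h j - \<bar>\<delta>h Phi\<bar>) + conc h Phi j * \<delta>h Phi"
    using width by (simp add: Phi_grad_def depth_increment_def abs_mult algebra_simps)
  then have "Phi_left S P b x h q Phi j
      = conc h Phi j * (h j - \<delta>h Phi) - \<delta>\<phi> Phi * (h j - \<bar>\<delta>h Phi\<bar>)"
    unfolding Phi_left_def by (subst Phi) (simp add: algebra_simps)
  moreover have "h_left S P b x h q Phi j = h j - \<delta>h Phi"
    by (simp add: h_left_def depth_increment_def)
  moreover have "h j - \<delta>h Phi \<noteq> 0" using depth_increment_less[of Phi] by linarith
  moreover have "damping (h j) (- \<delta>h Phi) = (h j - \<bar>\<delta>h Phi\<bar>) / (h j - \<delta>h Phi)"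
    by (simp add: damping_def)
  ultimately show ?thesis
    by (simp only: conc_left_def diff_divide_distrib[of "conc h Phi j * _"] times_divide_eq_right
        nonzero_mult_div_cancel_right not_False_eq_True)
qed

lemmas damping_unit =
  damping_bounds[OF depth_increment_less]
  damping_bounds[of "- \<delta>h Phi" "h j" for Phi, unfolded abs_minus_cancel, OF depth_increment_less]

section \<open>Bounds and monotonicity in the neighbours\<close>

lemma conc_within_local_bounds:
  "conc_left S P b x h q Phi j \<in> {local_min S x (conc h Phi) j..local_max S x (conc h Phi) j}"
  "conc_right S P b x h q Phi j \<in> {local_min S x (conc h Phi) j..local_max S x (conc h Phi) j}"
proof -
  let ?v = "conc h Phi"
  let ?l = "alpha_left S x j * (?v j - ?v (j - 1))"
  let ?m = "alpha_mid S x j * (?v (j + 1) - ?v (j - 1))"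
  let ?r = "alpha_right S x j * (?v (j + 1) - ?v j)"
  \<comment> \<open>a damped increment stays between zero and any argument of the minmod\<close>
  have damped: "min 0 y \<le> \<delta>\<phi> Phi * r" "\<delta>\<phi> Phi * r \<le> max 0 y"
    if "y \<in> {?l, ?m, ?r}" "0 \<le> r" "r \<le> 1" for y r
  proof -
    have "min 0 y \<le> \<delta>\<phi> Phi" "\<delta>\<phi> Phi \<le> max 0 y"
      unfolding half_width_slope[OF width] using minmod3_bounds[OF that(1)] by auto
    moreover have "min 0 t \<le> t * r \<and> t * r \<le> max 0 t" for t :: real
      using that(2,3) by (auto simp: min_def max_def mult_le_0_iff zero_le_mult_iff
          mult_left_le mult_le_cancel_left1 intro: mult_left_le)
    ultimately show "min 0 y \<le> \<delta>\<phi> Phi * r" "\<delta>\<phi> Phi * r \<le> max 0 y"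
      by (smt (verit) min_def max_def)+
  qed
  have lo: "local_min S x ?v j \<le> ?v j" "local_min S x ?v j \<le> ?v j - ?l"
      "local_min S x ?v j \<le> ?v j + ?r"
    and up: "?v j \<le> local_max S x ?v j" "?v j - ?l \<le> local_max S x ?v j"
      "?v j + ?r \<le> local_max S x ?v j"
    by (simp_all add: local_min_def local_max_def)
  show "conc_left S P b x h q Phi j \<in> {local_min S x ?v j..local_max S x ?v j}"
    unfolding conc_left_eq using damped[of ?l "damping (h j) (- \<delta>h Phi)"] damping_unit lo up
    by (auto simp: min_def max_def split: if_splits)
  show "conc_right S P b x h q Phi j \<in> {local_min S x ?v j..local_max S x ?v j}"
    unfolding conc_right_eq using damped[of ?r "damping (h j) (\<delta>h Phi)"] damping_unit lo up
    by (auto simp: min_def max_def split: if_splits)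
qed

text \<open>
  The concentration \<open>\<phi>\<^bsub>j-1\<^esub>\<close> can only decrease the arguments of minmod, and \<open>\<phi>\<^bsub>j+1\<^esub>\<close> only increase
  them; the damping factor, which is nonnegative, depends on neither.
\<close>

lemma conc_left_mono_neighbour:
  assumes eq: "conc h Phi' j = conc h Phi j" "conc h Phi' (j + 1) = conc h Phi (j + 1)"
    and le: "conc h Phi (j - 1) \<le> conc h Phi' (j - 1)"
    and mid: "0 \<le> alpha_mid S x j"
  shows "conc_left S P b x h q Phi j \<le> conc_left S P b x h q Phi' j"
proof -
  have "\<delta>\<phi> Phi' \<le> \<delta>\<phi> Phi"
    unfolding half_width_slope[OF width] eq
    using alpha mid le by (intro minmod3_mono mult_left_mono) auto
  then have "\<delta>\<phi> Phi' * damping (h j) (- \<delta>h Phi) \<le> \<delta>\<phi> Phi * damping (h j) (- \<delta>h Phi)"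
    by (rule mult_right_mono) (rule damping_unit)
  then show ?thesis
    unfolding conc_left_eq eq depth_increment_cong[OF eq(1)] by simp
qed

lemma conc_right_mono_neighbour:
  assumes eq: "conc h Phi' j = conc h Phi j" "conc h Phi' (j - 1) = conc h Phi (j - 1)"
    and le: "conc h Phi (j + 1) \<le> conc h Phi' (j + 1)"
    and mid: "0 \<le> alpha_mid S x j"
  shows "conc_right S P b x h q Phi j \<le> conc_right S P b x h q Phi' j"
proof -
  have "\<delta>\<phi> Phi \<le> \<delta>\<phi> Phi'"
    unfolding half_width_slope[OF width] eq
    using alpha mid le by (intro minmod3_mono mult_left_mono) auto
  then have "\<delta>\<phi> Phi * damping (h j) (\<delta>h Phi) \<le> \<delta>\<phi> Phi' * damping (h j) (\<delta>h Phi)"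
    by (rule mult_right_mono) (rule damping_unit)
  then show ?thesis
    unfolding conc_right_eq eq depth_increment_cong[OF eq(1)] by simp
qed

end

section \<open>Monotonicity in the cell itself\<close>

locale raised_conc = wet_cell +
  fixes Phi Phi' :: field
  assumes neighbours: "conc h Phi' (j - 1) = conc h Phi (j - 1)"
      "conc h Phi' (j + 1) = conc h Phi (j + 1)"
    and conc_nonneg: "0 \<le> conc h Phi (j - 1)" "0 \<le> conc h Phi j" "0 \<le> conc h Phi (j + 1)"
    and gravity_pos: "grav_p P * conc h Phi j + grav_a P > 0"
    and raised: "conc h Phi j \<le> conc h Phi' j"
begin

abbreviation "c \<equiv> conc h Phi j"
abbreviation "c' \<equiv> conc h Phi' j"

text \<open>
  An increment of concentration cannot take away more than the fraction \<open>\<alpha>\<close> of the cell value, since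
  the neighbouring values are nonnegative.
\<close>

lemma conc_increment_le: "\<bar>\<delta>\<phi> Phi\<bar> \<le> \<alpha> * c"
proof -
  let ?l = "alpha_left S x j * (c - conc h Phi (j - 1))"
  let ?r = "alpha_right S x j * (conc h Phi (j + 1) - c)"
  have "min 0 ?r \<le> \<delta>\<phi> Phi" "\<delta>\<phi> Phi \<le> max 0 ?l"
    unfolding half_width_slope[OF width] by (intro minmod3_bounds; simp)+
  moreover have "a * (c - d) \<le> \<alpha> * c" if "0 \<le> a" "a \<le> \<alpha>" "0 \<le> d" for a d
  proof -
    have "a * (c - d) \<le> a * c" using that by (intro mult_left_mono) auto
    also have "\<dots> \<le> \<alpha> * c" using that conc_nonneg(2) by (intro mult_right_mono)
    finally show ?thesis .
  qed
  from this[of "alpha_left S x j" "conc h Phi (j - 1)"]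
    this[of "alpha_right S x j" "conc h Phi (j + 1)"]
  have "?l \<le> \<alpha> * c" "- ?r \<le> \<alpha> * c"
    using alpha alpha_up_bounds conc_nonneg by (auto simp: algebra_simps)
  moreover have "0 \<le> \<alpha> * c" using alpha_up_bounds conc_nonneg by simp
  ultimately show ?thesis by linarith
qed

lemma conc_increment_diff_le: "\<bar>\<delta>\<phi> Phi' - \<delta>\<phi> Phi\<bar> \<le> \<alpha> * (c' - c)"
proof -
  have "\<bar>a * d\<bar> \<le> \<alpha> * (c' - c)" if "a \<in> {0..\<alpha>}" "\<bar>d\<bar> = c' - c" for a d
    using that raised by (simp add: abs_mult mult_right_mono)
  from this[of "alpha_left S x j" "c' - c"] this[of "alpha_right S x j" "c - c'"]
  show ?thesis
    unfolding half_width_slope[OF width] neighbours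
    using alpha alpha_up_bounds raised
    by (intro minmod3_shifted_diff[where e = 0, simplified]) (auto simp: algebra_simps)
qed

lemma gamma_diff:
  assumes N: "bed_var S b x j > 0"
  shows "c * (\<bar>\<gamma> Phi' - \<gamma> Phi\<bar> * bed_var S b x j) \<le> blend_G S x j * (h_low * ((c' - c) / 3))"
proof -
  let ?N = "bed_var S b x j" and ?g = "blend_G S x j"
  define B B' where "B = B_fun P c (q j)" and "B' = B_fun P c' (q j)"
  define M M' where "M = max ?N B" and "M' = max ?N B'"
  have B: "B' \<le> B" "c * (B - B') \<le> B * ((c' - c) / 3)"
    unfolding B_def B'_def using gravity conc_nonneg gravity_pos raised
    by (intro B_fun_decrease; simp)+
  have M: "0 < M" "0 < M'" "M' \<le> M" "?N \<le> M'" using N B by (auto simp: M_def M'_def)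
  \<comment> \<open>the maximum inherits the relative rate of change of \<open>B\<close>\<close>
  have cM: "c * (M - M') \<le> M * ((c' - c) / 3)"
  proof (cases "B \<le> ?N")
    case True
    then have "M = M'" using B by (simp add: M_def M'_def)
    then show ?thesis using M raised by simp
  next
    case False
    then have "c * (M - M') \<le> c * (B - B')"
      using conc_nonneg by (intro mult_left_mono) (auto simp: M_def M'_def)
    then show ?thesis using B False by (simp add: M_def)
  qed
  have xi: "h_low / M \<le> h_low / M'"
    using M h_low_bounds by (intro divide_left_mono) auto
  have "\<bar>\<gamma> Phi' - \<gamma> Phi\<bar> \<le> \<bar>?g * (h_low / M' - 1) - ?g * (h_low / M - 1)\<bar>"
    unfolding gamma_clamp[OF N] M_def M'_def B_def B'_def by linarith
  also have "\<dots> = ?g * (h_low / M' - h_low / M)"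
    using xi G by (simp add: abs_mult flip: right_diff_distrib)
  finally have "c * (\<bar>\<gamma> Phi' - \<gamma> Phi\<bar> * ?N) \<le> c * (?g * (h_low / M' - h_low / M) * M')"
    using conc_nonneg M N xi G by (intro mult_left_mono mult_mono) auto
  also have "\<dots> = ?g * h_low / M * (c * (M - M'))"
    using M by (simp add: field_simps)
  also have "\<dots> \<le> ?g * h_low / M * (M * ((c' - c) / 3))"
    using cM M G h_low_bounds by (intro mult_left_mono) auto
  also have "\<dots> = ?g * (h_low * ((c' - c) / 3))" using M by simp
  finally show ?thesis .
qed

lemma depth_increment_diff_le:
  "c * \<bar>\<delta>h Phi' - \<delta>h Phi\<bar> \<le> blend_G S x j * (h j * ((c' - c) / 3))"
proof -
  have rhs: "blend_G S x j * (h_low * ((c' - c) / 3)) \<le> blend_G S x j * (h j * ((c' - c) / 3))"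
    using G h_low_bounds raised by (intro mult_left_mono mult_right_mono) auto
  have "\<delta>h Phi' - \<delta>h Phi = (\<gamma> Phi' - \<gamma> Phi) * bed_shift S b x h j"
    by (simp add: depth_increment_eq algebra_simps)
  then have le: "c * \<bar>\<delta>h Phi' - \<delta>h Phi\<bar> \<le> c * (\<bar>\<gamma> Phi' - \<gamma> Phi\<bar> * bed_var S b x j)"
    using bed_shift_le conc_nonneg by (simp add: abs_mult mult_left_mono)
  show ?thesis
  proof (cases "bed_var S b x j > 0")
    case True
    show ?thesis using le gamma_diff[OF True] rhs by linarith
  next
    case False
    then have "bed_var S b x j = 0" using bed_var_nonneg[of S b x j] by simp
    moreover have "0 \<le> blend_G S x j * (h j * ((c' - c) / 3))" using G depth raised by simp
    ultimately show ?thesis using le by simp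
  qed
qed

text \<open>
  Stated for either sign of the depth increment, so as to serve both ends of the cell.  The spare
  factor \<open>2/3 < 1\<close> is what the cube root in \<open>B\<close> leaves.
\<close>

lemma damping_diff_le:
  assumes K: "\<bar>K\<bar> = \<bar>\<delta>h Phi\<bar>" "\<bar>K'\<bar> = \<bar>\<delta>h Phi'\<bar>" "\<bar>K' - K\<bar> = \<bar>\<delta>h Phi' - \<delta>h Phi\<bar>"
  shows "\<alpha> * (c * \<bar>damping (h j) K' - damping (h j) K\<bar>) \<le> (1 - \<alpha>) * (c' - c)"
proof -
  let ?d = "\<bar>damping (h j) K' - damping (h j) K\<bar>"
  have "h j * ?d \<le> 2 * \<bar>\<delta>h Phi' - \<delta>h Phi\<bar>"
    using damping_lipschitz[of K "h j" K'] K depth_increment_less by simp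
  then have "c * (h j * ?d) \<le> 2 * (c * \<bar>\<delta>h Phi' - \<delta>h Phi\<bar>)"
    using mult_left_mono[OF _ conc_nonneg(2)] by fastforce
  also have "\<dots> \<le> 2 * (blend_G S x j * (h j * ((c' - c) / 3)))"
    using depth_increment_diff_le by (intro mult_left_mono) auto
  finally have "h j * (c * ?d) \<le> h j * (2 / 3 * (blend_G S x j * (c' - c)))"
    by (simp add: algebra_simps)
  then have "c * ?d \<le> 2 / 3 * (blend_G S x j * (c' - c))" using depth by simp
  moreover have "blend_G S x j * (c' - c) \<le> (1 - \<alpha>) * (c' - c)"
    using G raised by (intro mult_right_mono) auto
  moreover have "0 \<le> blend_G S x j * (c' - c)" using G raised by simp
  moreover have "\<alpha> * (c * ?d) \<le> 1 * (c * ?d)"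
    using alpha_up_bounds conc_nonneg by (intro mult_right_mono) auto
  ultimately show ?thesis by linarith
qed

lemma conc_right_mono_self: "conc_right S P b x h q Phi j \<le> conc_right S P b x h q Phi' j"
  unfolding conc_right_eq
proof (rule damped_increment_mono)
  show "\<bar>\<delta>\<phi> Phi\<bar> \<le> \<alpha> * c" by (rule conc_increment_le)
  show "\<bar>\<delta>\<phi> Phi' - \<delta>\<phi> Phi\<bar> \<le> \<alpha> * (c' - c)" by (rule conc_increment_diff_le)
  show "\<alpha> * (c * \<bar>damping (h j) (\<delta>h Phi') - damping (h j) (\<delta>h Phi)\<bar>) \<le> (1 - \<alpha>) * (c' - c)"
    by (rule damping_diff_le) (rule refl)+
  show "0 \<le> \<alpha>" by (rule alpha_up_bounds)
  show "0 \<le> damping (h j) (\<delta>h Phi')" "damping (h j) (\<delta>h Phi') \<le> 1"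
    by (rule damping_unit)+
qed (rule raised)

lemma conc_left_mono_self: "conc_left S P b x h q Phi j \<le> conc_left S P b x h q Phi' j"
proof -
  have "c + - \<delta>\<phi> Phi * damping (h j) (- \<delta>h Phi) \<le> c' + - \<delta>\<phi> Phi' * damping (h j) (- \<delta>h Phi')"
  proof (rule damped_increment_mono)
    show "\<bar>- \<delta>\<phi> Phi\<bar> \<le> \<alpha> * c" using conc_increment_le by (simp only: abs_minus_cancel)
    show "\<bar>- \<delta>\<phi> Phi' - - \<delta>\<phi> Phi\<bar> \<le> \<alpha> * (c' - c)" using conc_increment_diff_le by linarith
    show "\<alpha> * (c * \<bar>damping (h j) (- \<delta>h Phi') - damping (h j) (- \<delta>h Phi)\<bar>)
        \<le> (1 - \<alpha>) * (c' - c)"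
      by (rule damping_diff_le) linarith+
    show "0 \<le> \<alpha>" by (rule alpha_up_bounds)
    show "0 \<le> damping (h j) (- \<delta>h Phi')" "damping (h j) (- \<delta>h Phi') \<le> 1"
      by (rule damping_unit)+
  qed (rule raised)
  then show ?thesis unfolding conc_left_eq by (simp only: mult_minus_left diff_conv_add_uminus)
qed

end

section \<open>Monotonicity and bounds of the reconstructed concentrations\<close>

lemma conc_set_conc:
  assumes "h k \<noteq> 0"
  shows "conc h (set_conc h Phi k c) = (conc h Phi)(k := c)"
  using assms by (auto simp: conc_def set_conc_def)

theorem theorem4p4:
  fixes J j :: int
    and x :: grid
    and S :: limiter
    and P :: physical_constants
    and b :: bed
    and h q Phi :: field
  assumes grid: "strict_mono_on {0..J} x"
    and cell: "1 < j" "j < J"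
    and depth: "\<And>k. k \<in> {1..J} \<Longrightarrow> h k > 0"
    and Phi_nonneg: "\<And>k. k \<in> {1..J} \<Longrightarrow> Phi k \<ge> 0"
    and constants: "grav_p P > 0" "grav_a P \<ge> 0" "Froude P > 0"
    and B_defined: "grav_p P * conc h Phi j + grav_a P > 0"
    and alpha: "alpha_left S x j \<in> {0..1}" "alpha_mid S x j \<in> {0..1}"
      "alpha_right S x j \<in> {0..1}"
    and G: "0 < blend_G S x j" "blend_G S x j \<le> 1 - alpha_up S x j"
  shows
    "(mono_on {c. c \<ge> 0 \<and> grav_p P * c + grav_a P > 0}
        (\<lambda>c. conc_left S P b x h q (set_conc h Phi j c) j) \<and>
      mono_on {c. c \<ge> 0 \<and> grav_p P * c + grav_a P > 0}
        (\<lambda>c. conc_right S P b x h q (set_conc h Phi j c) j)) \<and>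
     (mono_on {0..} (\<lambda>c. conc_left S P b x h q (set_conc h Phi (j - 1) c) j) \<and>
      mono_on {0..} (\<lambda>c. conc_right S P b x h q (set_conc h Phi (j + 1) c) j)) \<and>
     (local_min S x (conc h Phi) j \<le> conc_left S P b x h q Phi j \<and>
      conc_left S P b x h q Phi j \<le> local_max S x (conc h Phi) j \<and>
      local_min S x (conc h Phi) j \<le> conc_right S P b x h q Phi j \<and>
      conc_right S P b x h q Phi j \<le> local_max S x (conc h Phi) j)"
proof -
  have alpha_mid: "0 \<le> alpha_mid S x j" using alpha by simp
  have "0 \<le> conc h Phi k" if "k \<in> {1..J}" for k
    using depth[OF that] Phi_nonneg[OF that] by (simp add: conc_def)
  then have nonneg: "0 \<le> conc h Phi (j - 1)" "0 \<le> conc h Phi (j + 1)"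
    using cell by auto
  have "x (j - 1) < x j" using strict_mono_onD[OF grid] cell by simp
  then interpret wet_cell S P b x h q j
    using cell depth constants alpha G by unfold_locales (auto simp: cell_width_def)
  have hj: "h j \<noteq> 0" using depth(2) by simp
  have raised: "raised_conc S P x h j (set_conc h Phi j c) (set_conc h Phi j c')"
    if "0 \<le> c" "grav_p P * c + grav_a P > 0" "c \<le> c'" for c c'
    using that nonneg hj by unfold_locales (auto simp: conc_set_conc)
  show ?thesis
  proof (intro conjI)
    show "mono_on {c. c \<ge> 0 \<and> grav_p P * c + grav_a P > 0}
        (\<lambda>c. conc_left S P b x h q (set_conc h Phi j c) j)"
      by (intro mono_onI raised_conc.conc_left_mono_self raised) auto
    show "mono_on {c. c \<ge> 0 \<and> grav_p P * c + grav_a P > 0}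
        (\<lambda>c. conc_right S P b x h q (set_conc h Phi j c) j)"
      by (intro mono_onI raised_conc.conc_right_mono_self raised) auto
    show "mono_on {0..} (\<lambda>c. conc_left S P b x h q (set_conc h Phi (j - 1) c) j)"
      using depth(1) alpha_mid
      by (intro mono_onI conc_left_mono_neighbour) (auto simp: conc_set_conc)
    show "mono_on {0..} (\<lambda>c. conc_right S P b x h q (set_conc h Phi (j + 1) c) j)"
      using depth(3) alpha_mid
      by (intro mono_onI conc_right_mono_neighbour) (auto simp: conc_set_conc)
  qed (use conc_within_local_bounds[of Phi] in auto)
qed

end
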